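(* Let $G$ be a graph and let $H$ be an attachment set of $G$. Then $$\eta(\mathfrak{a}(G,H))=\eta(\mathfrak{a}^n(G,H))$$ for any integer $n\ge 1$.
   Context: All graphs are finite and simple (not necessarily connected). The nullity $\eta(G)$ of a graph $G$ is $\dim\ker A(G)$, where $A(G)$ is the (real) adjacency matrix of $G$. An attachment set of $G$ is a cyclic $h$-tuple $H=(v_1,\dots,v_h)$ of vertices of $G$ with $h\ge 2$, in which a vertex may occur more than once. The altan $\mathfrak{a}(G,H)$ is the pair $(G',H')$, where $G'$ is the graph with vertex set $V(G')=V(G)\sqcup\{x_1,\dots,x_h\}\sqcup\{y_1,\dots,y_h\}$ (disjoint union, all $x_i$, $y_i$ being new distinct vertices) and edge set $E(G')=E(G)\sqcup\{v_ix_i,\,x_iy_i : 1\le i\le h\}\sqcup\{y_ix_{i+1} : 1\le i<h\}\sqcup\{y_hx_1\}$, and $H'=(y_1,\dots,y_h)$ is the induced attachment set, which is an attachment set of $G'$. The iterated altan is defined by $\mathfrak{a}^0(G,H)=(G,H)$, $\mathfrak{a}^1(G,H)=\mathfrak{a}(G,H)$ and $\mathfrak{a}^k(G,H)=\mathfrak{a}(\mathfrak{a}^{k-1}(G,H))$ for $k\ge 2$. The nullity of a pair (graph, attachment set) means the nullity of its graph. *)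

theory Defs
  imports Graph_Theory.Pair_Digraph "HOL-Library.Function_Algebras"
begin

text \<open>
  A finite simple graph is a \<^locale>\<open>pair_graph\<close>; an edge \<open>uv\<close> is represented by the two
  arcs \<open>(u, v)\<close> and \<open>(v, u)\<close>.
\<close>

definition adjacency :: "'a pair_pre_digraph \<Rightarrow> 'a \<Rightarrow> 'a \<Rightarrow> real" where
  "adjacency G u v = (if (u, v) \<in> parcs G then 1 else 0)"

text \<open>
  Vectors indexed by the vertex set are functions vanishing outside of it, so that the matrix
  is indexed by the vertices themselves and no ordering of them is needed.
\<close>

definition adjacency_kernel :: "'a pair_pre_digraph \<Rightarrow> ('a \<Rightarrow> real) set" where
  "adjacency_kernel G =
     {f. (\<forall>v. v \<notin> pverts G \<longrightarrow> f v = 0) \<and>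
         (\<forall>u\<in>pverts G. (\<Sum>v\<in>pverts G. adjacency G u v * f v) = 0)}"

interpretation fun_space: vector_space "\<lambda>(c::real) (f :: 'a \<Rightarrow> real) v. c * f v"
  by unfold_locales (auto simp: fun_eq_iff algebra_simps)

definition nullity :: "'a pair_pre_digraph \<Rightarrow> nat" where
  "nullity G = fun_space.dim (adjacency_kernel G)"

text \<open>
  The list lists one period of the cyclic tuple; indices start at \<open>0\<close> and are read modulo the
  length.
\<close>

definition attachment_set :: "'a pair_pre_digraph \<Rightarrow> 'a list \<Rightarrow> bool" where
  "attachment_set G H \<longleftrightarrow> 2 \<le> length H \<and> set H \<subseteq> pverts G"

text \<open>
  A vertex type closed under adjoining new vertices, so that the altan can be iterated within
  one type: \<open>Old\<close> is the left injection of the disjoint union in the definition of the altan,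
  and \<open>X i\<close>, \<open>Y i\<close> are the vertices added by the outermost altan step. The vertices of the
  initial graph enter through \<open>Base\<close>.
\<close>

datatype 'a altan_vertex = Base 'a | Old "'a altan_vertex" | X nat | Y nat

type_synonym 'a attached_graph = "'a pair_pre_digraph \<times> 'a list"

definition base :: "'a attached_graph \<Rightarrow> 'a altan_vertex attached_graph" where
  "base P = (case P of (G, H) \<Rightarrow>
     (\<lparr> pverts = Base ` pverts G, parcs = map_prod Base Base ` parcs G \<rparr>, map Base H))"

definition new_arcs :: "'a altan_vertex list \<Rightarrow> 'a altan_vertex rel" where
  "new_arcs H =
     {(Old (H ! i), X i) | i. i < length H} \<union>
     {(X i, Y i) | i. i < length H} \<union>
     {(Y i, X (Suc i mod length H)) | i. i < length H}"

definition altan :: "'a altan_vertex attached_graph \<Rightarrow> 'a altan_vertex attached_graph" where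
  "altan P = (case P of (G, H) \<Rightarrow>
     (\<lparr> pverts = Old ` pverts G \<union> X ` {..<length H} \<union> Y ` {..<length H},
        parcs = map_prod Old Old ` parcs G \<union> new_arcs H \<union> (new_arcs H)\<inverse> \<rparr>,
      map Y [0..<length H]))"

definition pair_nullity :: "'a attached_graph \<Rightarrow> nat" where
  "pair_nullity P = nullity (fst P)"

definition wf_attached :: "'a attached_graph \<Rightarrow> bool" where
  "wf_attached P \<longleftrightarrow> pair_graph (fst P) \<and> attachment_set (fst P) (snd P)"

lemma pair_graph_iff:
  "pair_graph G \<longleftrightarrow>
     finite (pverts G) \<and> parcs G \<subseteq> pverts G \<times> pverts G \<and> sym (parcs G) \<and> irrefl (parcs G)"
proof
  assume "pair_graph G"
  then interpret pair_graph G .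
  show "finite (pverts G) \<and> parcs G \<subseteq> pverts G \<times> pverts G \<and> sym (parcs G) \<and> irrefl (parcs G)"
    using pair_sym_arcs
    by (auto simp: symmetric_def irrefl_def dest: in_arcsD1 in_arcsD2 pair_no_loops)
next
  assume *: "finite (pverts G) \<and> parcs G \<subseteq> pverts G \<times> pverts G \<and> sym (parcs G) \<and> irrefl (parcs G)"
  then have "finite (parcs G)"
    by (meson finite_SigmaI finite_subset)
  with * show "pair_graph G"
    by unfold_locales (auto simp: symmetric_def irrefl_def)
qed

lemma wf_attached_base:
  assumes "wf_attached P"
  shows "wf_attached (base P)"
  using assms
  by (auto simp: wf_attached_def base_def attachment_set_def pair_graph_iff irrefl_def sym_def
      split: prod.splits)

lemma wf_attached_altan:
  assumes "wf_attached P"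
  shows "wf_attached (altan P)"
proof -
  obtain G H where P: "P = (G, H)" by (cases P)
  have G: "pair_graph G" and H: "2 \<le> length H" "set H \<subseteq> pverts G"
    using assms by (auto simp: wf_attached_def attachment_set_def P)
  have N: "new_arcs H \<subseteq> pverts (fst (altan P)) \<times> pverts (fst (altan P))"
  proof
    fix e assume "e \<in> new_arcs H"
    then obtain i where i: "i < length H"
      and e: "e \<in> {(Old (H ! i), X i), (X i, Y i), (Y i, X (Suc i mod length H))}"
      by (auto simp: new_arcs_def)
    have "H ! i \<in> pverts G" "Suc i mod length H < length H"
      using H i by (auto intro: mod_less_divisor)
    with i e show "e \<in> pverts (fst (altan P)) \<times> pverts (fst (altan P))"
      by (auto simp: altan_def P)
  qed
  have I: "irrefl (new_arcs H)"
    by (auto simp: new_arcs_def irrefl_def)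
  have "sym (map_prod Old Old ` parcs G)"
    using G by (auto simp: pair_graph_iff sym_def)
  then have "sym (parcs (fst (altan P)))"
    by (auto simp: altan_def P sym_def)
  moreover have "irrefl (parcs (fst (altan P)))"
    using G I by (auto simp: altan_def P irrefl_def pair_graph_iff)
  moreover have "parcs (fst (altan P)) \<subseteq> pverts (fst (altan P)) \<times> pverts (fst (altan P))"
    using G N by (auto simp: altan_def P pair_graph_iff)
  moreover have "finite (pverts (fst (altan P)))"
    using G by (auto simp: altan_def P pair_graph_iff)
  ultimately have "pair_graph (fst (altan P))"
    by (simp add: pair_graph_iff)
  moreover have "attachment_set (fst (altan P)) (snd (altan P))"
    using H by (auto simp: altan_def P attachment_set_def)
  ultimately show ?thesis by (simp add: wf_attached_def)
qed

end

theory Submission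
  imports Defs
begin

text \<open>
  It suffices that a second altan step preserves the nullity, since every iterated altan beyond
  the first is an altan of an altan.

  A kernel vector of the first altan consists of values \<open>g v\<close> on the old vertices and two
  cyclic sequences \<open>x\<close>, \<open>y\<close> with \<open>x i + x (i + 1) = 0\<close> and
  \<open>g (v i) + y i + y (i - 1) = 0\<close>, where \<open>v i\<close> is the attachment vertex at \<open>x i\<close>. The second
  step adds sequences \<open>x'\<close>, \<open>y'\<close> with \<open>x' i + x' (i + 1) = 0\<close> and
  \<open>y i + y' i + y' (i - 1) = 0\<close>, and perturbs the equation at \<open>y i\<close> to
  \<open>x i + x (i + 1) + x' i = 0\<close>. The perturbation is void: \<open>x'\<close> alternates in sign, so it is zero
  for odd length \<open>h\<close>, and for even \<open>h\<close> the alternating sum of the perturbed equations says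
  \<open>h * x' 0 = 0\<close> (lemma \<open>cyclic_system_coupled_eq_0\<close>). Hence a kernel vector of the second altan
  is one of the first together with a solution \<open>y'\<close> of a cyclic system with right-hand side
  \<open>- y\<close> (lemma \<open>in_kernel_altan_altan_iff\<close>).

  For odd \<open>h\<close> that system has exactly one solution. For even \<open>h\<close> it is solvable only if the
  alternating sum of \<open>y\<close> vanishes, which costs one dimension because alternating vectors on the
  \<open>y i\<close> lie in the kernel of the first altan; the solution then has one free parameter
  \<open>y' 0\<close>, which returns the dimension. The linear map \<open>fold_altan\<close> makes this count an explicit
  isomorphism: it adds \<open>y' 0\<close> times the alternating vector to \<open>y\<close> and forgets \<open>x'\<close> and \<open>y'\<close>.
\<close>

section \<open>Cyclic alternating sums\<close>

lemma cyclic_alternating: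
  fixes a :: "nat \<Rightarrow> real"
  assumes "\<And>i. i < h \<Longrightarrow> a i + a (Suc i mod h) = 0" and "i < h"
  shows "a i = (-1) ^ i * a 0"
  using assms(2)
proof (induction i)
  case (Suc i)
  then have "a i + a (Suc i) = 0"
    using assms(1)[of i] by simp
  with Suc show ?case by simp
qed simp

text \<open>
  Going once around an odd cycle flips the sign, so the value at \<open>0\<close> equals its own negative.
\<close>

lemma odd_cyclic_alternating_eq_0:
  fixes a :: "nat \<Rightarrow> real"
  assumes "\<And>i. i < h \<Longrightarrow> a i + a (Suc i mod h) = 0" and "odd h" and "i < h"
  shows "a i = 0"
proof -
  have "h - 1 < h" "even (h - 1)" "Suc (h - 1) = h"
    using assms(2) by (auto elim: oddE)
  with assms(1)[of "h - 1"] cyclic_alternating[of h a "h - 1"] assms(1)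
  have "a 0 = 0" by simp
  then show ?thesis
    using cyclic_alternating[of h a i] assms by simp
qed

text \<open>
  The sum telescopes around the cycle; the last and the first term match because the sign is
  well defined modulo an even \<open>h\<close>. This is the solvability condition of the cyclic systems below.
\<close>

lemma even_alternating_sum_eq_0:
  fixes a :: "nat \<Rightarrow> real"
  assumes "even h"
  shows "(\<Sum>i<h. (-1) ^ i * (a i + a (Suc i mod h))) = 0"
proof (cases h)
  case (Suc n)
  have telescope: "(\<Sum>i<m. (-1) ^ i * (a i + a (Suc i))) = a 0 - (-1) ^ m * a m" for m
    by (induction m) (simp_all add: algebra_simps)
  have "(\<Sum>i<h. (-1) ^ i * (a i + a (Suc i mod h)))
      = (\<Sum>i<n. (-1) ^ i * (a i + a (Suc i))) + (-1) ^ n * (a n + a 0)"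
    by (simp add: Suc)
  also have "\<dots> = 0"
    using assms by (simp add: telescope Suc)
  finally show ?thesis .
qed simp

text \<open>
  Here \<open>a\<close> plays the role of the values on the vertices \<open>X i\<close> of the second altan step, and \<open>b\<close>
  that of the values on the vertices \<open>X i\<close> of the first. For even \<open>h\<close> the alternating sum of the
  second system kills \<open>b\<close> and collects \<open>h\<close> copies of \<open>a 0\<close>.
\<close>

lemma cyclic_system_coupled_eq_0:
  fixes a b :: "nat \<Rightarrow> real"
  assumes a: "\<And>i. i < h \<Longrightarrow> a i + a (Suc i mod h) = 0"
    and b: "\<And>i. i < h \<Longrightarrow> b i + b (Suc i mod h) + a i = 0"
    and "i < h"
  shows "a i = 0"
proof (cases "even h")
  case True
  have "(-1) ^ j * (b j + b (Suc j mod h)) = - a 0" if "j < h" for j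
  proof -
    have "b j + b (Suc j mod h) = - ((-1) ^ j * a 0)"
      using b[OF that] cyclic_alternating[of h a, OF a that] by simp
    then show ?thesis by (simp flip: mult.assoc power_mult_distrib)
  qed
  then have "(\<Sum>j<h. (-1) ^ j * (b j + b (Suc j mod h))) = - (real h * a 0)"
    by simp
  then have "a 0 = 0"
    using even_alternating_sum_eq_0[OF True, of b] \<open>i < h\<close> by simp
  then show ?thesis
    using cyclic_alternating[of h a, OF a \<open>i < h\<close>] by simp
qed (use odd_cyclic_alternating_eq_0[of h a] assms in blast)

text \<open>
  Solve the recursion \<open>a (i + 1) = b i - a i\<close> from a start value and close the cycle. For odd \<open>h\<close>
  the closing equation determines the start value; for even \<open>h\<close> it is the condition on \<open>b\<close>, and
  the start value remains free.
\<close>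

lemma cyclic_system_solvable:
  fixes b :: "nat \<Rightarrow> real"
  assumes "even h \<Longrightarrow> (\<Sum>i<h. (-1) ^ i * b i) = 0"
  obtains a where "\<And>i. i < h \<Longrightarrow> a i + a (Suc i mod h) = b i" and "even h \<Longrightarrow> a 0 = t"
proof -
  \<comment> \<open>The start value: for odd \<open>h\<close>, it is the solution of \<open>a h = a 0\<close>.\<close>
  define s where "s = (if even h then t else (\<Sum>i<h. (-1) ^ i * b i) / 2)"
  define a where "a i = (-1) ^ i * (s - (\<Sum>j<i. (-1) ^ j * b j))" for i
  have step: "a i + a (Suc i) = b i" for i
    by (simp add: a_def algebra_simps flip: power_add mult.assoc)
  have "a h = a 0"
    using assms by (simp add: a_def s_def)
  have "a i + a (Suc i mod h) = b i" if "i < h" for i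
    using step[of i] that \<open>a h = a 0\<close> by (cases "Suc i = h") auto
  moreover have "a 0 = t" if "even h"
    using that by (simp add: a_def s_def)
  ultimately show thesis by (rule that)
qed

section \<open>Kernels of adjacency matrices\<close>

definition neighbour_sum :: "'a pair_pre_digraph \<Rightarrow> ('a \<Rightarrow> real) \<Rightarrow> 'a \<Rightarrow> real" where
  "neighbour_sum G f u = (\<Sum>v\<in>pverts G. adjacency G u v * f v)"

lemma subspace_adjacency_kernel: "fun_space.subspace (adjacency_kernel G)"
  by (auto simp: fun_space.subspace_def adjacency_kernel_def algebra_simps sum.distrib
      simp flip: sum_distrib_left)

interpretation fun_space_pair: vector_space_pair
    "\<lambda>(c::real) (f :: 'a \<Rightarrow> real) v. c * f v" "\<lambda>(c::real) (f :: 'b \<Rightarrow> real) v. c * f v"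
  by unfold_locales

text \<open>
  A linear isomorphism of kernels maps a basis to a basis. Working with a basis of the kernel
  itself avoids any finiteness assumption on the ambient function spaces, which may be
  infinite-dimensional.
\<close>

lemma nullity_eqI:
  assumes "Vector_Spaces.linear (\<lambda>c f v. c * f v) (\<lambda>c f v. c * f v) T"
    and "\<And>f. f \<in> adjacency_kernel G \<Longrightarrow> T f = 0 \<Longrightarrow> f = 0"
    and "T ` adjacency_kernel G = adjacency_kernel G'"
  shows "nullity G = nullity G'"
proof -
  let ?K = "adjacency_kernel G"
  obtain B where B: "B \<subseteq> ?K" "fun_space.independent B" "?K \<subseteq> fun_space.span B"
      "card B = fun_space.dim ?K"
    using fun_space.basis_exists by blast
  have span: "fun_space.span B = ?K"
    using B fun_space.span_minimal[OF _ subspace_adjacency_kernel] by blast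
  have inj: "inj_on T ?K"
    using fun_space_pair.linear_inj_on_iff_eq_0[OF assms(1) subspace_adjacency_kernel] assms(2)
    by blast
  have "fun_space.independent (T ` B)"
    using fun_space_pair.linear_independent_injective_image[OF assms(1) B(2)] inj span by simp
  moreover have "fun_space.span (T ` B) = adjacency_kernel G'"
    using fun_space_pair.linear_span_image[OF assms(1), of B] span assms(3) by simp
  moreover have "card (T ` B) = card B"
    using inj B(1) by (intro card_image) (rule inj_on_subset)
  ultimately show ?thesis
    using B(4) fun_space.dim_eq_card[of "T ` B" "adjacency_kernel G'"]
    by (simp add: nullity_def fun_space.span_eq_iff[THEN iffD2, OF subspace_adjacency_kernel])
qed

section \<open>The kernel of an altan\<close>

lemma Suc_mod_eq_iff: "i < h \<Longrightarrow> j < h \<Longrightarrow> Suc i mod h = Suc j mod h \<longleftrightarrow> i = j"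
  by (auto simp: mod_Suc split: if_splits)

lemma Suc_mod_neq: "2 \<le> h \<Longrightarrow> i < h \<Longrightarrow> Suc i mod h \<noteq> i"
  by (auto simp: mod_Suc split: if_splits)

text \<open>
  Reindexing by the cyclic successor: the vertex \<open>X i\<close> is joined to \<open>Y i\<close> and to the \<open>Y\<close>-vertex of
  the cyclic predecessor of \<open>i\<close>. Naming the vertex \<open>X (Suc i mod h)\<close> instead avoids predecessors.
\<close>

lemma all_less_Suc_mod:
  assumes "0 < h"
  shows "(\<forall>i<h. P (Suc i mod h)) \<longleftrightarrow> (\<forall>i<h. P i)"
proof (intro iffI allI impI)
  fix i assume *: "\<forall>i<h. P (Suc i mod h)" and "i < h"
  show "P i"
  proof (cases i)
    case 0
    then show ?thesis using *[rule_format, of "h - 1"] assms by simp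
  next
    case (Suc j)
    then show ?thesis using *[rule_format, of j] \<open>i < h\<close> by simp
  qed
qed (use assms in auto)

lemma pverts_altan:
  "pverts (fst (altan (G, H))) = Old ` pverts G \<union> X ` {..<length H} \<union> Y ` {..<length H}"
  by (simp add: altan_def)

lemma snd_altan: "snd (altan (G, H)) = map Y [0..<length H]"
  by (simp add: altan_def)

lemma adjacency_altan:
  fixes G H
  defines "A \<equiv> adjacency (fst (altan (G, H)))" and "h \<equiv> length H"
  shows "A (Old u) (Old v) = adjacency G u v"
    and "i < h \<Longrightarrow> A (Old u) (X i) = of_bool (H ! i = u)"
    and "A (Old u) (Y i) = 0"
    and "i < h \<Longrightarrow> A (X i) (Old u) = of_bool (H ! i = u)"
    and "A (X i) (X j) = 0"
    and "i < h \<Longrightarrow> j < h \<Longrightarrow> A (X i) (Y j) = of_bool (j = i \<or> i = Suc j mod h)"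
    and "A (Y i) (Old u) = 0"
    and "i < h \<Longrightarrow> j < h \<Longrightarrow> A (Y i) (X j) = of_bool (j = i \<or> j = Suc i mod h)"
    and "A (Y i) (Y j) = 0"
  by (auto simp: A_def h_def adjacency_def altan_def new_arcs_def)

lemma neighbour_sum_altan:
  assumes "finite (pverts G)"
  shows "neighbour_sum (fst (altan (G, H))) f w =
    (\<Sum>v\<in>pverts G. adjacency (fst (altan (G, H))) w (Old v) * f (Old v)) +
    (\<Sum>i<length H. adjacency (fst (altan (G, H))) w (X i) * f (X i)) +
    (\<Sum>i<length H. adjacency (fst (altan (G, H))) w (Y i) * f (Y i))"
proof -
  let ?c = "\<lambda>v. adjacency (fst (altan (G, H))) w v * f v"
  have "sum ?c (Old ` pverts G \<union> X ` {..<length H} \<union> Y ` {..<length H})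
      = sum ?c (Old ` pverts G) + sum ?c (X ` {..<length H}) + sum ?c (Y ` {..<length H})"
    using assms by (subst sum.union_disjoint; (subst sum.union_disjoint)?) auto
  also have "sum ?c (Old ` pverts G) = (\<Sum>v\<in>pverts G. ?c (Old v))"
    by (simp add: sum.reindex inj_on_def)
  also have "sum ?c (X ` {..<length H}) = (\<Sum>i<length H. ?c (X i))"
    by (simp add: sum.reindex inj_on_def)
  also have "sum ?c (Y ` {..<length H}) = (\<Sum>i<length H. ?c (Y i))"
    by (simp add: sum.reindex inj_on_def)
  finally show ?thesis
    by (simp only: neighbour_sum_def pverts_altan)
qed

text \<open>
  A vertex repeated in the attachment set gains one new neighbour for each occurrence, hence the
  sum over positions.
\<close>

lemma neighbour_sum_altan_Old:
  assumes "finite (pverts G)"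
  shows "neighbour_sum (fst (altan (G, H))) f (Old u) =
    neighbour_sum G (\<lambda>v. f (Old v)) u + (\<Sum>i | i < length H \<and> H ! i = u. f (X i))"
proof -
  have "(\<Sum>i<length H. of_bool (H ! i = u) * f (X i)) = (\<Sum>i | i < length H \<and> H ! i = u. f (X i))"
    by (rule sum.mono_neutral_cong_right) auto
  then show ?thesis
    unfolding neighbour_sum_altan[OF assms] by (simp add: adjacency_altan neighbour_sum_def)
qed

lemma sum_of_bool_two:
  assumes "finite A" "p \<in> A" "q \<in> A" "p \<noteq> q"
  shows "(\<Sum>x\<in>A. of_bool (x = p \<or> x = q) * f x) = f p + (f q :: real)"
proof -
  have "(\<Sum>x\<in>A. of_bool (x = p \<or> x = q) * f x) = (\<Sum>x\<in>{p, q}. f x)"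
    by (rule sum.mono_neutral_cong_right) (use assms in auto)
  then show ?thesis using assms by simp
qed

text \<open>
  The two neighbours are distinct because an attachment set has at least two entries; for a single
  entry the two edges would coincide.
\<close>

lemma neighbour_sum_altan_Y:
  assumes "finite (pverts G)" "2 \<le> length H" "i < length H"
  shows "neighbour_sum (fst (altan (G, H))) f (Y i) = f (X i) + f (X (Suc i mod length H))"
proof -
  let ?i' = "Suc i mod length H"
  have i': "?i' < length H" "?i' \<noteq> i"
    using mod_less_divisor[of "length H" "Suc i"] Suc_mod_neq[OF assms(2,3)] assms(3)
    by linarith+
  have "(\<Sum>j<length H. adjacency (fst (altan (G, H))) (Y i) (X j) * f (X j))
      = (\<Sum>j<length H. of_bool (j = i \<or> j = ?i') * f (X j))"
    using assms(3) by (intro sum.cong) (simp_all add: adjacency_altan del: of_bool_or_iff)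
  also have "\<dots> = f (X i) + f (X ?i')"
    by (rule sum_of_bool_two) (use assms(3) i' in auto)
  finally show ?thesis
    by (simp add: neighbour_sum_altan[OF assms(1)] adjacency_altan(7,9))
qed

lemma neighbour_sum_altan_X:
  assumes "finite (pverts G)" "attachment_set G H" "i < length H"
  defines "i' \<equiv> Suc i mod length H"
  shows "neighbour_sum (fst (altan (G, H))) f (X i') = f (Old (H ! i')) + f (Y i') + f (Y i)"
proof -
  have "2 \<le> length H"
    using assms(2) by (simp add: attachment_set_def)
  then have i': "i' < length H" "i' \<noteq> i"
    unfolding i'_def
    using mod_less_divisor[of "length H" "Suc i"] Suc_mod_neq[of "length H" i] assms(3)
    by linarith+
  then have "H ! i' \<in> pverts G"
    using assms(2) by (auto simp: attachment_set_def)
  then have "(\<Sum>v\<in>pverts G. adjacency (fst (altan (G, H))) (X i') (Old v) * f (Old v))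
      = (\<Sum>v\<in>{H ! i'}. f (Old v))"
    by (intro sum.mono_neutral_cong_right)
      (use assms(1) i' in \<open>auto simp: adjacency_altan\<close>)
  moreover have "(\<Sum>j<length H. adjacency (fst (altan (G, H))) (X i') (Y j) * f (Y j))
      = (\<Sum>j<length H. of_bool (j = i' \<or> j = i) * f (Y j))"
    using i'(1) assms(3)
    by (intro sum.cong) (auto simp: adjacency_altan i'_def Suc_mod_eq_iff)
  moreover have "\<dots> = f (Y i') + f (Y i)"
    by (rule sum_of_bool_two) (use assms(3) i' in auto)
  ultimately show ?thesis
    by (simp add: neighbour_sum_altan[OF assms(1)] adjacency_altan(5))
qed

lemma in_kernel_altan_iff:
  assumes "wf_attached (G, H)"
  defines "h \<equiv> length H"
  shows "f \<in> adjacency_kernel (fst (altan (G, H))) \<longleftrightarrow>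
    (\<forall>w. w \<notin> pverts (fst (altan (G, H))) \<longrightarrow> f w = 0) \<and>
    (\<forall>u\<in>pverts G. neighbour_sum G (\<lambda>v. f (Old v)) u + (\<Sum>i | i < h \<and> H ! i = u. f (X i)) = 0) \<and>
    (\<forall>i<h. f (Old (H ! (Suc i mod h))) + f (Y (Suc i mod h)) + f (Y i) = 0) \<and>
    (\<forall>i<h. f (X i) + f (X (Suc i mod h)) = 0)"
proof -
  have fin: "finite (pverts G)" and att: "attachment_set G H" and h: "2 \<le> length H"
    using assms by (auto simp: wf_attached_def pair_graph_iff attachment_set_def)
  have "0 < length H" using h by linarith
  have "(\<forall>w\<in>pverts (fst (altan (G, H))). neighbour_sum (fst (altan (G, H))) f w = 0) \<longleftrightarrow>
    (\<forall>u\<in>pverts G. neighbour_sum (fst (altan (G, H))) f (Old u) = 0) \<and>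
    (\<forall>i<h. neighbour_sum (fst (altan (G, H))) f (X i) = 0) \<and>
    (\<forall>i<h. neighbour_sum (fst (altan (G, H))) f (Y i) = 0)"
    by (auto simp: pverts_altan h_def)
  moreover have "(\<forall>i<h. neighbour_sum (fst (altan (G, H))) f (X i) = 0) \<longleftrightarrow>
    (\<forall>i<h. neighbour_sum (fst (altan (G, H))) f (X (Suc i mod h)) = 0)"
    using all_less_Suc_mod[OF \<open>0 < length H\<close>, of "\<lambda>i. neighbour_sum (fst (altan (G, H))) f (X i) = 0"]
    by (simp add: h_def)
  ultimately show ?thesis
    unfolding adjacency_kernel_def neighbour_sum_def[symmetric]
    by (simp add: neighbour_sum_altan_Old neighbour_sum_altan_X neighbour_sum_altan_Y fin att h h_def)
qed

section \<open>The kernel of a twofold altan\<close>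

text \<open>
  The three systems for the new vertices apply to the second step. The attachment vertices are now
  the \<open>Y i\<close> of the first step, each used once, so only the equations at \<open>Old (Y i)\<close> could differ
  from those of the first altan. The coupled cyclic systems force the perturbation \<open>f (X i)\<close> to
  vanish, and the equations of the first altan are recovered.
\<close>

lemma in_kernel_altan_altan_iff:
  assumes wf: "wf_attached (G, H)"
  defines "h \<equiv> length H"
  shows "f \<in> adjacency_kernel (fst (altan (altan (G, H)))) \<longleftrightarrow>
    (\<forall>w. w \<notin> pverts (fst (altan (altan (G, H)))) \<longrightarrow> f w = 0) \<and>
    (\<lambda>v. f (Old v)) \<in> adjacency_kernel (fst (altan (G, H))) \<and>
    (\<forall>i<h. f (X i) = 0) \<and>
    (\<forall>i<h. f (Old (Y (Suc i mod h))) + f (Y (Suc i mod h)) + f (Y i) = 0)"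
    (is "?L \<longleftrightarrow> ?S \<and> ?K \<and> ?X \<and> ?Y")
proof -
  define G' where "G' = fst (altan (G, H))"
  define H' where "H' = (map Y [0..<h] :: 'a altan_vertex list)"
  have GH': "altan (G, H) = (G', H')"
    by (simp add: G'_def H'_def h_def prod_eq_iff snd_altan)
  have [simp]: "length H' = h" by (simp add: H'_def)
  have wf': "wf_attached (G', H')"
    using wf_attached_altan[OF wf] by (simp add: GH')
  have fin: "finite (pverts G)" and att: "attachment_set G H" and h: "2 \<le> h"
    using wf by (auto simp: wf_attached_def pair_graph_iff attachment_set_def h_def)
  have suc: "Suc i mod h < h" for i
    using h by (intro mod_less_divisor) linarith
  have L: "?L \<longleftrightarrow> ?S \<and>
      (\<forall>w\<in>pverts G'. neighbour_sum G' (\<lambda>v. f (Old v)) w + (\<Sum>i | i < h \<and> H' ! i = w. f (X i)) = 0) \<and>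
      ?Y \<and> (\<forall>i<h. f (X i) + f (X (Suc i mod h)) = 0)"
    unfolding GH' in_kernel_altan_iff[OF wf'] using suc by (simp add: H'_def)
  have K: "?K \<longleftrightarrow> (\<forall>w. w \<notin> pverts G' \<longrightarrow> f (Old w) = 0) \<and>
      (\<forall>w\<in>pverts G'. neighbour_sum G' (\<lambda>v. f (Old v)) w = 0)"
    by (simp add: adjacency_kernel_def neighbour_sum_def G'_def)
  have supp: "f (Old w) = 0" if ?S "w \<notin> pverts G'" for w
  proof -
    have "Old w \<notin> pverts (fst (altan (altan (G, H))))"
      unfolding GH' pverts_altan using that(2) by auto
    with that(1) show ?thesis by blast
  qed
  show ?thesis
  proof (cases "?X")
    case True
    then have "(\<Sum>i | i < h \<and> H' ! i = w. f (X i)) = 0" for w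
      by simp
    then show ?thesis
      unfolding L K using True supp suc by auto
  next
    case False
    have ?X if ?L
    proof (intro allI impI)
      fix i assume "i < h"
      \<comment> \<open>The equation at the vertex \<open>Old (Y j)\<close>.\<close>
      have "f (Old (X j)) + f (Old (X (Suc j mod h))) + f (X j) = 0" if "j < h" for j
      proof -
        have "Y j \<in> pverts G'"
          using \<open>j < h\<close> by (simp add: G'_def pverts_altan h_def)
        with \<open>?L\<close>[unfolded L]
        have "neighbour_sum G' (\<lambda>v. f (Old v)) (Y j) + (\<Sum>i | i < h \<and> H' ! i = Y j. f (X i)) = 0"
          by blast
        moreover have "{i. i < h \<and> H' ! i = Y j} = {j}"
          using \<open>j < h\<close> by (auto simp: H'_def)
        ultimately show ?thesis
          using neighbour_sum_altan_Y[OF fin, of H j] h \<open>j < h\<close> by (simp add: G'_def h_def)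
      qed
      moreover have "f (X j) + f (X (Suc j mod h)) = 0" if "j < h" for j
        using \<open>?L\<close>[unfolded L] that by blast
      ultimately show "f (X i) = 0"
        using \<open>i < h\<close>
        by (intro cyclic_system_coupled_eq_0[of h "\<lambda>i. f (X i)" "\<lambda>i. f (Old (X i))"]) auto
    qed
    with False show ?thesis by blast
  qed
qed

text \<open>
  The vector is zero for odd \<open>h\<close>, where alternating signs do not close up around the cycle. This
  lets the parity-dependent isomorphism below be given by one formula.
\<close>

definition alternating_vector :: "nat \<Rightarrow> 'a altan_vertex \<Rightarrow> real" where
  "alternating_vector h w = (case w of Y i \<Rightarrow> if even h \<and> i < h then (-1) ^ i else 0 | _ \<Rightarrow> 0)"

text \<open>
  The vector is supported on the \<open>Y i\<close>, so only the equations at the \<open>X i\<close> see it, and there the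
  two neighbouring signs cancel.
\<close>

lemma alternating_vector_in_kernel:
  assumes "wf_attached (G, H)"
  shows "alternating_vector (length H) \<in> adjacency_kernel (fst (altan (G, H)))"
proof -
  have h: "2 \<le> length H"
    using assms by (auto simp: wf_attached_def attachment_set_def)
  have "neighbour_sum G (\<lambda>v. alternating_vector (length H) (Old v)) u = 0" for u
    by (simp add: neighbour_sum_def alternating_vector_def)
  moreover have "alternating_vector (length H) (Y (Suc i mod length H)) +
      alternating_vector (length H) (Y i :: 'a altan_vertex) = 0" if "i < length H" for i
  proof (cases "Suc i = length H")
    case True
    then have "length H = Suc i" by simp
    then show ?thesis by (simp add: alternating_vector_def)
  qed (use that in \<open>simp add: alternating_vector_def\<close>)
  ultimately show ?thesis
    unfolding in_kernel_altan_iff[OF assms]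
    by (auto simp: alternating_vector_def pverts_altan split: altan_vertex.split)
qed

text \<open>
  Restriction to the inner altan, corrected by the one parameter that the restriction loses for
  even \<open>h\<close>: the solutions \<open>f (Y i)\<close> of the outer cyclic system are determined by their value at
  \<open>Y 0\<close>, which is stored along the alternating vector. That direction is free, because
  restrictions have a vanishing alternating sum over the \<open>Y i\<close>.
\<close>

definition fold_altan :: "nat \<Rightarrow> ('a altan_vertex \<Rightarrow> real) \<Rightarrow> 'a altan_vertex \<Rightarrow> real" where
  "fold_altan h f w = f (Old w) + f (Y 0) * alternating_vector h w"

lemma linear_fold_altan:
  "Vector_Spaces.linear (\<lambda>c f v. c * f v) (\<lambda>c f v. c * f v) (fold_altan h)"
  by unfold_locales (auto simp: fold_altan_def fun_eq_iff algebra_simps)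

text \<open>
  If \<open>f\<close> folds to zero, its restriction is the multiple \<open>- f (Y 0)\<close> of the alternating vector. For
  even \<open>h\<close> the alternating sum of the restriction vanishes by solvability, which forces
  \<open>f (Y 0) = 0\<close>. So the restriction is zero, and the outer values \<open>f (Y i)\<close> alternate starting
  from \<open>0\<close> (even \<open>h\<close>) or alternate around an odd cycle; either way they vanish.
\<close>

lemma fold_altan_eq_0_imp:
  assumes wf: "wf_attached (G, H)"
    and f: "f \<in> adjacency_kernel (fst (altan (altan (G, H))))"
    and fold: "fold_altan (length H) f = 0"
  shows "f = 0"
proof -
  define h where "h = length H"
  have h: "2 \<le> h"
    using wf by (auto simp: wf_attached_def attachment_set_def h_def)
  have suc: "Suc i mod h < h" for i
    using h by (intro mod_less_divisor) linarith
  have supp: "f w = 0" if "w \<notin> pverts (fst (altan (altan (G, H))))" for w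
    using f that by (simp add: adjacency_kernel_def)
  have X0: "f (X i) = 0" if "i < h" for i
    using f that unfolding in_kernel_altan_altan_iff[OF wf] h_def by blast
  have Y: "f (Old (Y (Suc i mod h))) + f (Y (Suc i mod h)) + f (Y i) = 0" if "i < h" for i
    using f that unfolding in_kernel_altan_altan_iff[OF wf] h_def by blast
  have Old: "f (Old w) = - (f (Y 0) * alternating_vector h w)" for w
    using fun_cong[OF fold, of w] by (simp add: fold_altan_def h_def)
  have c: "f (Y 0) * alternating_vector h w = 0" for w :: "'a altan_vertex"
  proof (cases "even h")
    case True
    have "(-1) ^ i * (f (Y i) + f (Y (Suc i mod h))) = - f (Y 0)" if "i < h" for i
    proof -
      have "(-1) ^ (Suc i mod h) = - ((-1) ^ i :: real)"
        using that True by (cases "Suc i = h") auto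
      then have "f (Y i) + f (Y (Suc i mod h)) = - (f (Y 0) * (-1) ^ i)"
        using Y[OF that] Old[of "Y (Suc i mod h)"] suc[of i] True
        by (simp add: alternating_vector_def)
      then show ?thesis by (simp flip: mult.assoc power_mult_distrib)
    qed
    then have "(\<Sum>i<h. (-1) ^ i * (f (Y i) + f (Y (Suc i mod h)))) = - (real h * f (Y 0))"
      by simp
    then show ?thesis
      using even_alternating_sum_eq_0[OF True, of "\<lambda>i. f (Y i)"] h by simp
  qed (simp add: alternating_vector_def split: altan_vertex.split)
  then have Old0: "f (Old w) = 0" for w
    using Old by simp
  then have Y': "f (Y i) + f (Y (Suc i mod h)) = 0" if "i < h" for i
    using Y[OF that] by simp
  have Y0: "f (Y i) = 0" if "i < h" for i
  proof (cases "even h")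
    case True
    then have "f (Y 0) = 0"
      using c[of "Y 0"] h by (simp add: alternating_vector_def)
    then show ?thesis
      using cyclic_alternating[of h "\<lambda>i. f (Y i)", OF Y' that] by simp
  qed (use odd_cyclic_alternating_eq_0[of h "\<lambda>i. f (Y i)", OF Y' _ that] in blast)
  have "f w = 0" for w
  proof (cases w)
    case (X i)
    then show ?thesis
      using X0 supp[of w] by (cases "i < h") (auto simp: altan_def h_def)
  next
    case (Y i)
    then show ?thesis
      using Y0 supp[of w] by (cases "i < h") (auto simp: altan_def h_def)
  next
    case (Base v)
    then show ?thesis using supp[of w] by (auto simp: altan_def)
  qed (simp add: Old0)
  then show ?thesis by (simp add: fun_eq_iff)
qed

text \<open>
  To lift \<open>g\<close>, subtract the multiple \<open>t\<close> of the alternating vector that makes the alternating sum of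
  its \<open>Y\<close>-values zero, and solve the outer cyclic system with start value \<open>t\<close>.
\<close>

lemma fold_altan_image_kernel:
  assumes wf: "wf_attached (G, H)"
  shows "fold_altan (length H) ` adjacency_kernel (fst (altan (altan (G, H))))
    = adjacency_kernel (fst (altan (G, H)))"
proof
  define h where "h = length H"
  have h: "2 \<le> h"
    using wf by (auto simp: wf_attached_def attachment_set_def h_def)
  have shift: "(\<lambda>w. g w + c * alternating_vector h w) \<in> adjacency_kernel (fst (altan (G, H)))"
    if "g \<in> adjacency_kernel (fst (altan (G, H)))" for g c
    using fun_space.subspace_add[OF subspace_adjacency_kernel that
        fun_space.subspace_scale[OF subspace_adjacency_kernel alternating_vector_in_kernel[OF wf]]]
    by (simp add: plus_fun_def h_def)
  show "fold_altan (length H) ` adjacency_kernel (fst (altan (altan (G, H))))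
      \<subseteq> adjacency_kernel (fst (altan (G, H)))"
    using shift
    by (auto simp: in_kernel_altan_altan_iff[OF wf] fold_altan_def[abs_def] h_def)
  show "adjacency_kernel (fst (altan (G, H)))
      \<subseteq> fold_altan (length H) ` adjacency_kernel (fst (altan (altan (G, H))))"
  proof
    fix g assume g: "g \<in> adjacency_kernel (fst (altan (G, H)))"
    \<comment> \<open>For even \<open>h\<close>, the alternating vector has alternating sum \<open>h\<close>.\<close>
    define t where "t = (\<Sum>i<h. (-1) ^ i * g (Y i)) / real h"
    define g' where "g' w = g w - t * alternating_vector h w" for w
    have g': "g' \<in> adjacency_kernel (fst (altan (G, H)))"
      using shift[OF g, of "- t"] by (simp add: g'_def[abs_def])
    have sum_g': "(\<Sum>i<h. (-1) ^ i * g' (Y (Suc i mod h))) = 0" if "even h"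
    proof -
      have "(\<Sum>i<h. (-1) ^ i * g' (Y i)) = (\<Sum>i<h. (-1) ^ i * g (Y i) - t)"
        using that
        by (intro sum.cong) (auto simp: g'_def alternating_vector_def algebra_simps simp flip: power_add)
      also have "\<dots> = 0"
        using h by (simp add: sum_subtractf t_def)
      finally show ?thesis
        using even_alternating_sum_eq_0[OF that, of "\<lambda>i. g' (Y i)"]
        by (simp add: distrib_left sum.distrib)
    qed
    obtain a where a: "\<And>i. i < h \<Longrightarrow> a i + a (Suc i mod h) = - g' (Y (Suc i mod h))"
      and a0: "even h \<Longrightarrow> a 0 = t"
      using cyclic_system_solvable[of h "\<lambda>i. - g' (Y (Suc i mod h))" t] sum_g'
      by (auto simp: sum_negf)
    have system: "g' (Y (Suc i mod h)) + a (Suc i mod h) + a i = 0" if "i < h" for i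
      using a[OF that] by simp
    define f where "f w = (case w of Old v \<Rightarrow> g' v | Y i \<Rightarrow> if i < h then a i else 0 | _ \<Rightarrow> 0)" for w
    have "f w = 0" if "w \<notin> pverts (fst (altan (altan (G, H))))" for w
    proof -
      have "g' v = 0" if "v \<notin> pverts (fst (altan (G, H)))" for v
        using g' that by (simp add: adjacency_kernel_def)
      then show ?thesis
        using that pverts_altan[of "fst (altan (G, H))" "snd (altan (G, H))"]
        unfolding prod.collapse by (auto simp: f_def h_def snd_altan split: altan_vertex.split)
    qed
    moreover have "Suc i mod h < h" for i
      using h by (intro mod_less_divisor) linarith
    ultimately have "f \<in> adjacency_kernel (fst (altan (altan (G, H))))"
      unfolding in_kernel_altan_altan_iff[OF wf] h_def[symmetric]
      using g' system by (auto simp: f_def)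
    moreover have "fold_altan h f = g"
      using a0 h
      by (auto simp: fun_eq_iff fold_altan_def f_def g'_def alternating_vector_def
          split: altan_vertex.split)
    ultimately show "g \<in> fold_altan (length H) ` adjacency_kernel (fst (altan (altan (G, H))))"
      by (auto simp: h_def)
  qed
qed

section \<open>Iterated altans\<close>

lemma pair_nullity_altan_altan:
  assumes "wf_attached P"
  shows "pair_nullity (altan (altan P)) = pair_nullity (altan P)"
proof -
  obtain G H where P: "P = (G, H)" by (cases P)
  with assms have wf: "wf_attached (G, H)" by simp
  show ?thesis
    unfolding P pair_nullity_def
    by (intro nullity_eqI[OF linear_fold_altan fold_altan_eq_0_imp[OF wf]
          fold_altan_image_kernel[OF wf]])
qed

lemma wf_attached_iterated_altan: "wf_attached P \<Longrightarrow> wf_attached ((altan ^^ n) P)"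
  by (induction n) (auto intro: wf_attached_altan)

theorem corollary15:
  fixes G :: "'a pair_pre_digraph" and H :: "'a list" and n :: nat
  assumes "pair_graph G"
    and "attachment_set G H"
    and "n \<ge> 1"
  shows "pair_nullity (altan (base (G, H))) = pair_nullity ((altan ^^ n) (base (G, H)))"
  using assms(3)
proof (induction n rule: dec_induct)
  case (step n)
  have "wf_attached (base (G, H))"
    using assms(1,2) by (intro wf_attached_base) (simp add: wf_attached_def)
  moreover obtain m where "n = Suc m"
    using step.hyps(1) by (cases n) auto
  ultimately show ?case
    using step.IH pair_nullity_altan_altan[OF wf_attached_iterated_altan, of "base (G, H)" m]
    by simp
qed simp

end
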